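(* Let $p$ be a prime and $d,u$ positive integers with $u\ge 2$ if $p=2$, and let $\Gamma=\mathrm{CS}(u,d,p)$. If $k$ is a field of characteristic $p$, then the group ring $k[\Gamma]$ is a domain.
   Context: $\mathrm{CS}(i,d,p)=\{A\in \mathrm{Mat}_d(\mathbb{Z}_p)\mid A\equiv I_d \bmod p^i\}$, where $\mathbb{Z}_p$ denotes the $p$-adic integers; this is a group under matrix multiplication. *)

theory Defs
  imports "HOL-Algebra.Group" "HOL-Computational_Algebra.Primes"
begin

text \<open>A p-adic integer x is represented by the sequence of its residues:
  x n is the residue of x modulo p^n (in 0 ..< p^n), and the residues are compatible.
  This is the inverse limit description Z_p = lim Z/p^n Z.\<close>

definition zp_seq :: "nat \<Rightarrow> (nat \<Rightarrow> int) \<Rightarrow> bool" where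
  "zp_seq p x \<longleftrightarrow> (\<forall>n. 0 \<le> x n \<and> x n < int p ^ n \<and> x n = x (Suc n) mod int p ^ n)"

text \<open>A d x d matrix over Z_p is represented as A :: nat => nat => nat => int with
  A a b = the p-adic entry (a,b) (a residue sequence) for a,b < d, and A a b = 0 otherwise.\<close>

definition padic_mat :: "nat \<Rightarrow> nat \<Rightarrow> (nat \<Rightarrow> nat \<Rightarrow> nat \<Rightarrow> int) set" where
  "padic_mat p d = {A. (\<forall>a b. a < d \<and> b < d \<longrightarrow> zp_seq p (A a b))
                      \<and> (\<forall>a b. \<not> (a < d \<and> b < d) \<longrightarrow> A a b = (\<lambda>n. 0))}"

text \<open>Matrix product: computed residue-wise (reduction mod p^n is a ring homomorphism).\<close>
definition padic_mat_mult :: "nat \<Rightarrow> nat \<Rightarrow> (nat \<Rightarrow> nat \<Rightarrow> nat \<Rightarrow> int)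
    \<Rightarrow> (nat \<Rightarrow> nat \<Rightarrow> nat \<Rightarrow> int) \<Rightarrow> (nat \<Rightarrow> nat \<Rightarrow> nat \<Rightarrow> int)" where
  "padic_mat_mult p d A B = (\<lambda>a b n. if a < d \<and> b < d
      then (\<Sum>c<d. A a c n * B c b n) mod int p ^ n else 0)"

definition padic_mat_one :: "nat \<Rightarrow> nat \<Rightarrow> (nat \<Rightarrow> nat \<Rightarrow> nat \<Rightarrow> int)" where
  "padic_mat_one p d = (\<lambda>a b n. if a < d \<and> b < d \<and> a = b then 1 mod int p ^ n else 0)"

definition CS :: "nat \<Rightarrow> nat \<Rightarrow> nat \<Rightarrow> (nat \<Rightarrow> nat \<Rightarrow> nat \<Rightarrow> int) set" where
  "CS i d p = {A \<in> padic_mat p d. \<forall>a b. A a b i = padic_mat_one p d a b i}"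

definition CS_group :: "nat \<Rightarrow> nat \<Rightarrow> nat \<Rightarrow> (nat \<Rightarrow> nat \<Rightarrow> nat \<Rightarrow> int) monoid" where
  "CS_group i d p = \<lparr>carrier = CS i d p, monoid.mult = padic_mat_mult p d, one = padic_mat_one p d\<rparr>"

definition group_ring_carrier :: "('a, 'm) monoid_scheme \<Rightarrow> ('a \<Rightarrow> 'k::field) set" where
  "group_ring_carrier G = {f. finite {x. f x \<noteq> 0} \<and> {x. f x \<noteq> 0} \<subseteq> carrier G}"

definition group_ring_mult :: "('a, 'm) monoid_scheme \<Rightarrow> ('a \<Rightarrow> 'k::field) \<Rightarrow> ('a \<Rightarrow> 'k) \<Rightarrow> ('a \<Rightarrow> 'k)" where
  "group_ring_mult G f g = (\<lambda>x. \<Sum>y\<in>{y. f y \<noteq> 0}. \<Sum>z\<in>{z. g z \<noteq> 0}.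
       if y \<otimes>\<^bsub>G\<^esub> z = x then f y * g z else 0)"

text \<open>k[G] is a domain: no zero divisors (k being a field, 1 is nonzero).\<close>
definition group_ring_is_domain :: "('a, 'm) monoid_scheme \<Rightarrow> 'k::field itself \<Rightarrow> bool" where
  "group_ring_is_domain G TYPE('k) \<longleftrightarrow>
     (\<forall>f\<in>(group_ring_carrier G :: ('a \<Rightarrow> 'k) set). \<forall>g\<in>group_ring_carrier G.
        f \<noteq> (\<lambda>_. 0) \<longrightarrow> g \<noteq> (\<lambda>_. 0) \<longrightarrow> group_ring_mult G f g \<noteq> (\<lambda>_. 0))"

end

theory Submission
  imports Defs "HOL-Computational_Algebra.Polynomial" "HOL-Library.FuncSet"
begin

text \<open>Write the elements of the group as \<open>1 + p ^ u * X\<close>. In the coordinates given by the entries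
  of \<open>X\<close> the product is \<open>X + Y + p ^ u * X * Y\<close>. Functions \<open>x choose n\<close> of the coordinates take
  well-defined values in \<open>k\<close>; their products, graded by the sum of the lower indices, span a
  filtered algebra of functions which separates points. By Vandermonde and
  \<open>(1 + T) ^ (p ^ u * w) = (1 + T ^ (p ^ u)) ^ w\<close> in characteristic \<open>p\<close>, the group law agrees with the
  addition of coordinates up to functions of lower degree, because \<open>X * Y\<close> is quadratic and \<open>p ^ u > 2\<close>.
  Hence, evaluating elements of the group ring as functionals on these functions, the lowest degree
  part of a product is the product of the lowest degree parts in a polynomial ring, which is a
  domain.\<close>

section \<open>Binomial coefficients in characteristic p\<close>

text \<open>Split \<open>x\<close> as \<open>m + (x - m)\<close>, apply Vandermonde to
  \<open>x choose n\<close>, and absorb \<open>x choose m\<close> into each term. For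
  \<open>x < m\<close> both sides vanish.\<close>

lemma choose_times_choose:
  "(x choose m) * (x choose n) = (\<Sum>l\<le>n. (m choose (n - l)) * ((m + l) choose m) * (x choose (m + l)))"
proof (cases "m \<le> x")
  case True
  have "x choose n = (m + (x - m)) choose n" using True by simp
  also have "\<dots> = (\<Sum>l\<le>n. (m choose (n - l)) * ((x - m) choose l))"
    unfolding add.commute[of m] vandermonde[symmetric] by (simp add: mult.commute)
  finally have "(x choose m) * (x choose n)
      = (\<Sum>l\<le>n. (m choose (n - l)) * ((x choose m) * ((x - m) choose l)))"
    by (simp add: sum_distrib_left mult_ac)
  moreover have "(x choose m) * ((x - m) choose l) = ((m + l) choose m) * (x choose (m + l))" for l
    using choose_mult[of m "m + l" x] by (cases "m + l \<le> x") (auto simp: mult_ac binomial_eq_0)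
  ultimately show ?thesis by (simp add: mult.assoc)
qed (simp add: binomial_eq_0)

text \<open>The coefficients do not depend on \<open>x\<close>, so the span of the binomial
  functions is closed under products; this supplies \<open>b_mult\<close> below.\<close>

lemma of_nat_choose_times_choose_span:
  "\<exists>q. \<forall>x. of_nat (x choose m) * of_nat (x choose n)
     = (\<Sum>c\<le>m + n. q c * (of_nat (x choose c) :: 'k::comm_ring_1))"
proof (intro exI allI)
  fix x
  let ?q = "\<lambda>c. if m \<le> c then of_nat ((m choose (n - (c - m))) * (c choose m)) else (0 :: 'k)"
  have "(\<Sum>c\<le>m + n. ?q c * of_nat (x choose c)) = (\<Sum>c\<in>{m..m + n}. ?q c * of_nat (x choose c))"
    by (intro sum.mono_neutral_right) auto
  also have "\<dots> = (\<Sum>l\<le>n. ?q (m + l) * of_nat (x choose (m + l)))"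
    by (intro sum.reindex_bij_witness[of _ "\<lambda>l. m + l" "\<lambda>c. c - m"]) auto
  also have "\<dots> = of_nat ((x choose m) * (x choose n))"
    unfolding choose_times_choose by simp
  finally show "of_nat (x choose m) * of_nat (x choose n) = (\<Sum>c\<le>m + n. ?q c * of_nat (x choose c))"
    by simp
qed

text \<open>Compare the coefficients of \<open>T ^ j\<close> in
  \<open>(1 + T) ^ (q * w) = (1 + T ^ q) ^ w\<close>.\<close>

lemma of_nat_choose_CHAR_power_mult:
  fixes u :: nat
  defines "q \<equiv> CHAR('k::comm_ring_1) ^ u"
  assumes "prime CHAR('k)"
  shows "of_nat ((q * w) choose j) = (if q dvd j then of_nat (w choose (j div q)) else (0 :: 'k))"
proof -
  have q: "q > 0" using assms by (simp add: prime_gt_0_nat)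
  have lin: "coeff ([:1, 1:] ^ n) i = (of_nat (n choose i) :: 'k)" for n i
  proof (cases "i \<le> n")
    case False
    have "degree ([:1, 1:: 'k:] ^ n) \<le> n"
      using degree_power_le[of "[:1, 1:: 'k:]" n] by (simp split: if_splits)
    then show ?thesis using False by (simp add: coeff_eq_0 binomial_eq_0)
  qed (simp add: coeff_linear_poly_power)
  have "[:1, 1 :: 'k:] = monom 1 1 + 1"
    by (simp add: monom_altdef one_pCons)
  then have "[:1, 1 :: 'k:] ^ q = monom 1 q + 1"
    using assms(2) freshmans_dream'[of q u "monom 1 1" "1 :: 'k poly"] by (simp add: q_def monom_power)
  then have "[:1, 1 :: 'k:] ^ (q * w) = (\<Sum>k\<le>w. of_nat (w choose k) * monom 1 (q * k))"
    by (simp add: power_mult binomial_ring monom_power)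
  then have "of_nat ((q * w) choose j) = (\<Sum>k\<le>w. of_nat (w choose k) * (if q * k = j then 1 else (0 :: 'k)))"
    by (simp add: lin[symmetric] coeff_sum of_nat_poly)
  also have "\<dots> = (if q dvd j then of_nat (w choose (j div q)) else 0)"
  proof (cases "q dvd j")
    case True
    then obtain r where "j = q * r" ..
    then show ?thesis using q by (auto simp: if_distrib binomial_eq_0 cong: if_cong)
  qed (auto intro!: sum.neutral)
  finally show ?thesis .
qed

text \<open>In Vandermonde's sum for \<open>x = ?q * (x div ?q) + x mod ?q\<close> the terms with
  \<open>0 < k \<le> n < ?q\<close> vanish.\<close>

lemma of_nat_choose_mod_CHAR_power:
  assumes "prime CHAR('k::comm_ring_1)" and "n < CHAR('k) ^ N"
  shows "of_nat ((x mod CHAR('k) ^ N) choose n) = (of_nat (x choose n) :: 'k)"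
proof -
  let ?q = "CHAR('k) ^ N"
  have "of_nat (x choose n) = (of_nat ((?q * (x div ?q) + x mod ?q) choose n) :: 'k)"
    by simp
  also have "\<dots> = (\<Sum>k\<le>n. of_nat ((?q * (x div ?q)) choose k) * of_nat ((x mod ?q) choose (n - k)))"
    unfolding vandermonde[symmetric] by simp
  also have "\<dots> = (\<Sum>k\<le>n. if k = 0 then of_nat ((x mod ?q) choose n) else 0)"
    using assms by (intro sum.cong) (auto simp: of_nat_choose_CHAR_power_mult dest: dvd_imp_le)
  finally show ?thesis by simp
qed

text \<open>\<open>choose_pow b x m\<close> is the coefficient of \<open>T ^ m\<close> in \<open>((1 + T) ^ x - 1) ^ b\<close>.\<close>

primrec choose_pow :: "nat \<Rightarrow> nat \<Rightarrow> nat \<Rightarrow> nat" where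
  "choose_pow 0 x m = (if m = 0 then 1 else 0)"
| "choose_pow (Suc b) x m = (\<Sum>i=1..m. (x choose i) * choose_pow b x (m - i))"

lemma choose_pow_eq_0: "m < b \<Longrightarrow> choose_pow b x m = 0"
  by (induction b arbitrary: m) auto

text \<open>Expand \<open>(1 + T) ^ (x * y) = (1 + ((1 + T) ^ x - 1)) ^ y\<close> in powers of
  \<open>(1 + T) ^ x - 1\<close>.\<close>

lemma choose_of_mult: "(x * y) choose m = (\<Sum>b\<le>m. (y choose b) * choose_pow b x m)"
proof -
  \<comment> \<open>The limit \<open>M\<close> stays fixed while the induction passes from
    \<open>m\<close> to \<open>m - i\<close>; the extra terms are zero.\<close>
  have "(x * y) choose m = (\<Sum>b\<le>M. (y choose b) * choose_pow b x m)" if "m \<le> M" for M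
    using that
  proof (induction y arbitrary: m)
    case 0
    have "(\<Sum>b\<le>M. (0 choose b) * choose_pow b x m) = (\<Sum>b\<le>M. if b = 0 then choose_pow 0 x m else 0)"
      by (intro sum.cong) auto
    then show ?case by simp
  next
    case (Suc y)
    have "(x * Suc y) choose m = (\<Sum>i\<le>m. (x choose i) * ((x * y) choose (m - i)))"
      by (simp add: vandermonde)
    also have "\<dots> = ((x * y) choose m) + (\<Sum>i=1..m. (x choose i) * ((x * y) choose (m - i)))"
      by (simp add: atMost_atLeast0 sum.atLeast_Suc_atMost[of 0])
    also have "(\<Sum>i=1..m. (x choose i) * ((x * y) choose (m - i)))
        = (\<Sum>i=1..m. \<Sum>b\<le>M. (y choose b) * ((x choose i) * choose_pow b x (m - i)))"
      using Suc by (intro sum.cong) (auto simp: sum_distrib_left mult_ac)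
    also have "\<dots> = (\<Sum>b\<le>M. (y choose b) * choose_pow (Suc b) x m)"
      by (subst sum.swap) (simp add: sum_distrib_left)
    also have "\<dots> = (\<Sum>b<M. (y choose b) * choose_pow (Suc b) x m)"
      using Suc.prems choose_pow_eq_0[of m "Suc M"] by (simp flip: lessThan_Suc_atMost del: choose_pow.simps)
    also have "(x * y) choose m = choose_pow 0 x m + (\<Sum>b<M. (y choose Suc b) * choose_pow (Suc b) x m)"
      using Suc by (simp add: sum.atMost_shift del: choose_pow.simps)
    finally show ?case
      by (simp add: sum.atMost_shift algebra_simps sum.distrib del: choose_pow.simps)
  qed
  then show ?thesis by simp
qed

text \<open>Minimise one coordinate after another in \<open>S\<close> and \<open>T\<close>: equal
  sums force \<open>s'\<close> and \<open>t'\<close> to be minimal there as well. This is the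
  lexicographic argument by which a polynomial ring is a domain.\<close>

lemma exists_unique_sum:
  fixes S T :: "('i \<Rightarrow> nat) set"
  assumes "finite I" and "S \<noteq> {}" and "T \<noteq> {}"
  shows "\<exists>s\<in>S. \<exists>t\<in>T. \<forall>s'\<in>S. \<forall>t'\<in>T. (\<forall>i\<in>I. s' i + t' i = s i + t i)
           \<longrightarrow> (\<forall>i\<in>I. s' i = s i)"
  using assms
proof (induction I arbitrary: S T)
  case empty
  then show ?case by auto
next
  case (insert i I)
  let ?min = "\<lambda>S. {s \<in> S. \<forall>s'\<in>S. s i \<le> s' i}"
  have min: "?min S \<noteq> {}" if "S \<noteq> {}" for S :: "('i \<Rightarrow> nat) set"
    using ex_has_least_nat[of "\<lambda>s. s \<in> S" _ "\<lambda>s. s i"] that by blast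
  obtain s t where st: "s \<in> ?min S" "t \<in> ?min T" and
    uniq: "\<forall>s'\<in>?min S. \<forall>t'\<in>?min T. (\<forall>j\<in>I. s' j + t' j = s j + t j) \<longrightarrow> (\<forall>j\<in>I. s' j = s j)"
    using insert.IH[OF min[OF insert.prems(1)] min[OF insert.prems(2)]] by (elim bexE)
  have "\<forall>j\<in>insert i I. s' j = s j"
    if "s' \<in> S" "t' \<in> T" "\<forall>j\<in>insert i I. s' j + t' j = s j + t j" for s' t'
  proof -
    have "s i \<le> s' i" "t i \<le> t' i" "s' i + t' i = s i + t i"
      using st that by auto
    then have "s' i = s i" "t' i = t i" by auto
    moreover have "s' \<in> ?min S" "t' \<in> ?min T" using calculation st that by auto
    then have "\<forall>j\<in>I. s' j = s j" using uniq that(3) by blast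
    ultimately show ?thesis by simp
  qed
  then show ?case using st by blast
qed

section \<open>Filtered algebras of binomial functions\<close>

text \<open>Think of \<open>b j n x\<close> as the value in \<open>k\<close> of
  \<open>x_j choose n\<close>, where \<open>x_j\<close> is the \<open>j\<close>-th coordinate of
  \<open>x\<close>.\<close>

locale binomial_family =
  fixes J :: "'j set" and b :: "'j \<Rightarrow> nat \<Rightarrow> 'x \<Rightarrow> 'k::field" and X :: "'x set"
  assumes finite_J: "finite J"
    and b_0: "\<lbrakk>j \<in> J; x \<in> X\<rbrakk> \<Longrightarrow> b j 0 x = 1"
    and b_mult: "j \<in> J \<Longrightarrow> \<exists>q. \<forall>x\<in>X. b j m x * b j n x = (\<Sum>c\<le>m + n. q c * b j c x)"
begin

definition mon :: "('j \<Rightarrow> nat) \<Rightarrow> 'x \<Rightarrow> 'k" where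
  "mon \<alpha> x = (\<Prod>j\<in>J. b j (\<alpha> j) x)"

text \<open>Functions that agree on \<open>X\<close> with a linear combination of monomials of degree strictly
  below \<open>n\<close>; the strict bound makes \<open>filt 0\<close> the zero functions.\<close>

inductive filt :: "nat \<Rightarrow> ('x \<Rightarrow> 'k) \<Rightarrow> bool" for n where
  zero: "(\<And>x. x \<in> X \<Longrightarrow> \<phi> x = 0) \<Longrightarrow> filt n \<phi>"
| add_mon: "filt n \<phi> \<Longrightarrow> sum \<alpha> J < n \<Longrightarrow> (\<And>x. x \<in> X \<Longrightarrow> \<psi> x = \<phi> x + c * mon \<alpha> x) \<Longrightarrow> filt n \<psi>"

lemma filt_cong:
  assumes "filt n \<phi>" and "\<And>x. x \<in> X \<Longrightarrow> \<psi> x = \<phi> x"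
  shows "filt n \<psi>"
  using assms by cases (auto intro: filt.intros)

lemma filt_mono:
  assumes "filt n \<phi>" and "n \<le> m"
  shows "filt m \<phi>"
  using assms(1)
proof (induction rule: filt.induct)
  case (zero \<phi>)
  then show ?case by (rule filt.zero)
next
  case (add_mon \<phi> \<alpha> \<psi> c)
  show ?case
    using add_mon.hyps(2) assms(2) by (intro filt.add_mon[OF add_mon.IH _ add_mon.hyps(3)]) auto
qed

lemma filt_add:
  assumes "filt n \<phi>" and "filt n \<psi>"
  shows "filt n (\<lambda>x. \<phi> x + \<psi> x)"
  using assms
proof (induction rule: filt.induct)
  case (zero \<phi>)
  then show ?case by (auto intro: filt_cong)
next
  case (add_mon \<phi> \<alpha> \<chi> c)
  show ?case
    by (rule filt.add_mon[OF add_mon.IH[OF add_mon.prems] add_mon.hyps(2), of _ c])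
      (simp add: add_mon.hyps)
qed

lemma filt_scale:
  assumes "filt n \<phi>"
  shows "filt n (\<lambda>x. r * \<phi> x)"
  using assms
proof (induction rule: filt.induct)
  case (zero \<phi>)
  then show ?case by (auto intro: filt.zero)
next
  case (add_mon \<phi> \<alpha> \<chi> c)
  show ?case
    by (rule filt.add_mon[OF add_mon.IH add_mon.hyps(2), of _ "r * c"])
      (simp add: add_mon.hyps algebra_simps)
qed

lemma filt_sum:
  assumes "\<And>i. i \<in> A \<Longrightarrow> filt n (\<phi> i)"
  shows "filt n (\<lambda>x. \<Sum>i\<in>A. \<phi> i x)"
  using assms by (induction A rule: infinite_finite_induct) (auto intro: filt.zero filt_add)

lemma filt_mon: "sum \<alpha> J < n \<Longrightarrow> filt n (mon \<alpha>)"
  by (rule filt.add_mon[of n "\<lambda>_. 0" \<alpha> _ 1]) (auto intro: filt.zero)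

lemma filt_const: "filt (Suc n) (\<lambda>_. c)"
  by (rule filt.add_mon[of _ "\<lambda>_. 0" "\<lambda>_. 0" _ c]) (auto intro: filt.zero simp: mon_def b_0)

lemma filt_gen:
  assumes "j \<in> J"
  shows "filt (Suc n) (b j n)"
proof -
  have "mon (\<lambda>i. if i = j then n else 0) x = b j n x" if "x \<in> X" for x
  proof -
    have "mon (\<lambda>i. if i = j then n else 0) x = (\<Prod>i\<in>J. if i = j then b j n x else 1)"
      unfolding mon_def using that by (intro prod.cong) (auto simp: b_0)
    then show ?thesis using assms finite_J by simp
  qed
  moreover have "filt (Suc n) (mon (\<lambda>i. if i = j then n else 0))"
    using assms finite_J by (intro filt_mon) simp
  ultimately show ?thesis by (auto elim: filt_cong)
qed

text \<open>Expand each factor by \<open>b_mult\<close> and multiply out; every resulting exponent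
  has \<open>\<gamma> j \<le> \<alpha> j + \<beta> j\<close>.\<close>

lemma filt_mon_mult:
  assumes "sum \<alpha> J + sum \<beta> J < n"
  shows "filt n (\<lambda>x. mon \<alpha> x * mon \<beta> x)"
proof -
  have "\<forall>j. \<exists>q. j \<in> J \<longrightarrow> (\<forall>x\<in>X. b j (\<alpha> j) x * b j (\<beta> j) x = (\<Sum>c\<le>\<alpha> j + \<beta> j. q c * b j c x))"
    using b_mult by blast
  then obtain q where q: "\<And>j x. j \<in> J \<Longrightarrow> x \<in> X \<Longrightarrow>
      b j (\<alpha> j) x * b j (\<beta> j) x = (\<Sum>c\<le>\<alpha> j + \<beta> j. q j c * b j c x)"
    by metis
  let ?P = "PiE J (\<lambda>j. {..\<alpha> j + \<beta> j})"
  have "filt n (\<lambda>x. \<Sum>\<gamma>\<in>?P. (\<Prod>j\<in>J. q j (\<gamma> j)) * mon \<gamma> x)"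
  proof (intro filt_sum filt_scale filt_mon)
    fix \<gamma> assume "\<gamma> \<in> ?P"
    then have "sum \<gamma> J \<le> (\<Sum>j\<in>J. \<alpha> j + \<beta> j)" by (intro sum_mono) auto
    then show "sum \<gamma> J < n" using assms by (simp add: sum.distrib)
  qed
  moreover have "mon \<alpha> x * mon \<beta> x = (\<Sum>\<gamma>\<in>?P. (\<Prod>j\<in>J. q j (\<gamma> j)) * mon \<gamma> x)" if "x \<in> X" for x
    using that finite_J
    by (simp add: mon_def prod.distrib[symmetric] q prod_sum_PiE)
  ultimately show ?thesis by (rule filt_cong)
qed

text \<open>Degrees at most \<open>m - 1\<close> and \<open>n - 1\<close> add up to at most
  \<open>m + n - 2\<close>, which the strict bound records as \<open>m + n - 1\<close>.\<close>

lemma filt_mult: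
  assumes "filt m \<phi>" and "filt n \<psi>"
  shows "filt (m + n - 1) (\<lambda>x. \<phi> x * \<psi> x)"
  using assms(1)
proof (induction rule: filt.induct)
  case (zero \<phi>)
  then show ?case by (auto intro: filt.zero)
next
  case (add_mon \<phi> \<alpha> \<chi> c)
  have "filt (m + n - 1) (\<lambda>x. mon \<alpha> x * \<psi> x)"
    using assms(2)
  proof (induction rule: filt.induct)
    case (zero \<psi>)
    then show ?case by (auto intro: filt.zero)
  next
    case (add_mon \<psi> \<beta> \<omega> r)
    have "filt (m + n - 1) (\<lambda>x. mon \<alpha> x * \<psi> x + r * (mon \<alpha> x * mon \<beta> x))"
      using add_mon \<open>sum \<alpha> J < m\<close> by (intro filt_add filt_scale filt_mon_mult) auto
    then show ?case by (rule filt_cong) (simp add: add_mon algebra_simps)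
  qed
  then have "filt (m + n - 1) (\<lambda>x. \<phi> x * \<psi> x + c * (mon \<alpha> x * \<psi> x))"
    using add_mon by (intro filt_add filt_scale) auto
  then show ?case by (rule filt_cong) (simp add: add_mon algebra_simps)
qed

lemma filt_mult_Suc: "filt (Suc m) \<phi> \<Longrightarrow> filt (Suc n) \<psi> \<Longrightarrow> filt (Suc (m + n)) (\<lambda>x. \<phi> x * \<psi> x)"
  using filt_mult[of "Suc m" \<phi> "Suc n" \<psi>] by simp

lemma filt_prod:
  assumes "finite A" and "\<And>i. i \<in> A \<Longrightarrow> filt (Suc (\<alpha> i)) (\<phi> i)"
  shows "filt (Suc (sum \<alpha> A)) (\<lambda>x. \<Prod>i\<in>A. \<phi> i x)"
  using assms by (induction A rule: finite_induct) (auto intro: filt_const filt_mult_Suc)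

text \<open>Each \<open>L i\<close> has degree below \<open>\<alpha> i\<close>, so it cannot affect
  the leading part of the product. The induction rests on
  \<open>(T + L) * P - T * Q = L * P + T * (P - Q)\<close>.\<close>

lemma filt_prod_perturb:
  assumes "finite A" and "\<And>i. i \<in> A \<Longrightarrow> filt (Suc (\<alpha> i)) (T i)" and "\<And>i. i \<in> A \<Longrightarrow> filt (\<alpha> i) (L i)"
  shows "filt (sum \<alpha> A) (\<lambda>x. (\<Prod>i\<in>A. T i x + L i x) - (\<Prod>i\<in>A. T i x))"
  using assms
proof (induction A rule: finite_induct)
  case empty
  then show ?case by (auto intro: filt.zero)
next
  case (insert i A)
  let ?P = "\<lambda>x. \<Prod>i\<in>A. T i x + L i x" and ?Q = "\<lambda>x. \<Prod>i\<in>A. T i x"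
  have "filt (Suc (sum \<alpha> A)) ?P"
    using insert.prems by (intro filt_prod filt_add insert.hyps) (auto intro: filt_mono[OF insert.prems(2)])
  then have "filt (\<alpha> i + sum \<alpha> A) (\<lambda>x. L i x * ?P x)"
    using filt_mult[of "\<alpha> i" "L i" "Suc (sum \<alpha> A)" ?P] insert by simp
  moreover have "filt (\<alpha> i + sum \<alpha> A) (\<lambda>x. T i x * (?P x - ?Q x))"
    using filt_mult[of "Suc (\<alpha> i)" "T i" "sum \<alpha> A" "\<lambda>x. ?P x - ?Q x"] insert by simp
  ultimately have "filt (\<alpha> i + sum \<alpha> A) (\<lambda>x. L i x * ?P x + T i x * (?P x - ?Q x))"
    by (rule filt_add)
  then show ?case
    using insert.hyps by (auto elim!: filt_cong simp: algebra_simps)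
qed

lemma sum_filt_eq_0:
  assumes "filt n \<phi>" and "S \<subseteq> X" and "\<And>\<alpha>. sum \<alpha> J < n \<Longrightarrow> (\<Sum>x\<in>S. f x * mon \<alpha> x) = 0"
  shows "(\<Sum>x\<in>S. f x * \<phi> x) = 0"
  using assms(1)
proof (induction rule: filt.induct)
  case (zero \<phi>)
  then show ?case using assms(2) by (intro sum.neutral) auto
next
  case (add_mon \<phi> \<alpha> \<psi> c)
  have "(\<Sum>x\<in>S. f x * \<psi> x) = (\<Sum>x\<in>S. f x * \<phi> x + c * (f x * mon \<alpha> x))"
    using assms(2) add_mon.hyps by (intro sum.cong) (auto simp: algebra_simps)
  also have "\<dots> = 0"
    using add_mon.IH assms(3)[OF add_mon.hyps(2)] by (simp add: sum.distrib flip: sum_distrib_left)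
  finally show ?case .
qed

text \<open>A function \<open>\<theta>\<close> with values in the natural numbers behaves like a polynomial of degree \<open>e\<close>.\<close>

definition nat_degree_le :: "nat \<Rightarrow> nat \<Rightarrow> ('x \<Rightarrow> nat) \<Rightarrow> bool" where
  "nat_degree_le N e \<theta> \<longleftrightarrow> (\<forall>m\<le>N. filt (Suc (e * m)) (\<lambda>x. of_nat (\<theta> x choose m)))"

lemma nat_degree_le_add:
  assumes "nat_degree_le N e \<theta>" and "nat_degree_le N e \<eta>"
  shows "nat_degree_le N e (\<lambda>x. \<theta> x + \<eta> x)"
  unfolding nat_degree_le_def
proof (intro allI impI)
  fix m assume m: "m \<le> N"
  have "filt (Suc (e * m)) (\<lambda>x. \<Sum>k\<le>m. of_nat (\<theta> x choose k) * of_nat (\<eta> x choose (m - k)))"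
  proof (rule filt_sum)
    fix k assume "k \<in> {..m}"
    then show "filt (Suc (e * m)) (\<lambda>x. of_nat (\<theta> x choose k) * of_nat (\<eta> x choose (m - k)))"
      using filt_mult_Suc[of "e * k" "\<lambda>x. of_nat (\<theta> x choose k)" "e * (m - k)"] assms m
      by (simp add: nat_degree_le_def flip: add_mult_distrib2)
  qed
  then show "filt (Suc (e * m)) (\<lambda>x. of_nat (\<theta> x + \<eta> x choose m))"
    by (simp flip: vandermonde)
qed

lemma nat_degree_le_sum:
  "(\<And>i. i \<in> A \<Longrightarrow> nat_degree_le N e (\<theta> i)) \<Longrightarrow> nat_degree_le N e (\<lambda>x. \<Sum>i\<in>A. \<theta> i x)"
proof (induction A rule: infinite_finite_induct)
  case (insert i A)
  then show ?case by (simp add: nat_degree_le_add)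
qed (simp_all add: nat_degree_le_def filt_const)

text \<open>In \<open>choose_of_mult\<close> the factor \<open>\<eta> x choose b\<close> with
  \<open>b \<le> m\<close> has degree at most \<open>e' * m\<close>, and \<open>choose_pow\<close>
  contributes \<open>e * m\<close>.\<close>

lemma nat_degree_le_mult:
  assumes "nat_degree_le N e \<theta>" and "nat_degree_le N e' \<eta>"
  shows "nat_degree_le N (e + e') (\<lambda>x. \<theta> x * \<eta> x)"
  unfolding nat_degree_le_def
proof (intro allI impI)
  fix m assume m: "m \<le> N"
  \<comment> \<open>The terms of \<open>choose_pow\<close> are products of binomials of
    \<open>\<theta> x\<close> whose lower indices add up to \<open>l\<close>, so the bound is
    independent of \<open>b\<close>.\<close>
  have pow: "filt (Suc (e * l)) (\<lambda>x. of_nat (choose_pow b (\<theta> x) l))" if "l \<le> N" for b l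
    using that
  proof (induction b arbitrary: l)
    case 0
    then show ?case by (simp add: filt_const)
  next
    case (Suc b)
    have "filt (Suc (e * l)) (\<lambda>x. \<Sum>i=1..l. of_nat (\<theta> x choose i) * of_nat (choose_pow b (\<theta> x) (l - i)))"
    proof (rule filt_sum)
      fix i assume "i \<in> {1..l}"
      then show "filt (Suc (e * l)) (\<lambda>x. of_nat (\<theta> x choose i) * of_nat (choose_pow b (\<theta> x) (l - i)))"
        using filt_mult_Suc[of "e * i" "\<lambda>x. of_nat (\<theta> x choose i)" "e * (l - i)"] assms(1) Suc
        by (simp add: nat_degree_le_def flip: add_mult_distrib2)
    qed
    then show ?case by simp
  qed
  have "filt (Suc ((e + e') * m)) (\<lambda>x. \<Sum>b\<le>m. of_nat (\<eta> x choose b) * of_nat (choose_pow b (\<theta> x) m))"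
  proof (rule filt_sum)
    fix b assume b: "b \<in> {..m}"
    have "filt (Suc (e' * b + e * m)) (\<lambda>x. of_nat (\<eta> x choose b) * of_nat (choose_pow b (\<theta> x) m))"
      using b m assms(2) pow by (intro filt_mult_Suc) (auto simp: nat_degree_le_def)
    then show "filt (Suc ((e + e') * m)) (\<lambda>x. of_nat (\<eta> x choose b) * of_nat (choose_pow b (\<theta> x) m))"
      by (rule filt_mono) (use b in \<open>simp add: add_mult_distrib\<close>)
  qed
  then show "filt (Suc ((e + e') * m)) (\<lambda>x. of_nat (\<theta> x * \<eta> x choose m))"
    by (simp add: choose_of_mult)
qed

end

section \<open>Functions of two points, in doubled coordinates\<close>

definition pair_family :: "('j \<Rightarrow> nat \<Rightarrow> 'x \<Rightarrow> 'k) \<Rightarrow> 'j + 'j \<Rightarrow> nat \<Rightarrow> 'x \<times> 'x \<Rightarrow> 'k" where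
  "pair_family b = case_sum (\<lambda>j n z. b j n (fst z)) (\<lambda>j n z. b j n (snd z))"

lemma pair_family_simps [simp]:
  "pair_family b (Inl j) n z = b j n (fst z)"
  "pair_family b (Inr j) n z = b j n (snd z)"
  by (simp_all add: pair_family_def)

context binomial_family begin

lemma binomial_family_pair: "binomial_family (J <+> J) (pair_family b) (X \<times> X)"
proof
  show "finite (J <+> J)" using finite_J by simp
  show "pair_family b j 0 z = 1" if "j \<in> J <+> J" "z \<in> X \<times> X" for j z
    using that by (auto simp: b_0)
  show "\<exists>q. \<forall>z\<in>X \<times> X. pair_family b j m z * pair_family b j n z = (\<Sum>c\<le>m + n. q c * pair_family b j c z)"
    if "j \<in> J <+> J" for j m n
    using that
  proof (rule PlusE)
    fix i assume i: "i \<in> J" "j = Inl i"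
    then show ?thesis using b_mult[OF i(1), of m n] by (auto simp: Ball_def)
  next
    fix i assume i: "i \<in> J" "j = Inr i"
    then show ?thesis using b_mult[OF i(1), of m n] by (auto simp: Ball_def)
  qed
qed

end

section \<open>Groups whose law is additive to leading order\<close>

text \<open>The main term of \<open>comult\<close> is Vandermonde's expansion of
  \<open>(x_i + y_i) choose n\<close>; the error \<open>L\<close> has degree strictly below
  \<open>n\<close>.\<close>

locale binomial_group = binomial_family I b "carrier G"
  for I :: "'i set" and b :: "'i \<Rightarrow> nat \<Rightarrow> 'x \<Rightarrow> 'k::field" and G :: "('x, 'm) monoid_scheme" (structure) +
  assumes separates: "\<lbrakk>x \<in> carrier G; y \<in> carrier G; x \<noteq> y\<rbrakk> \<Longrightarrow> \<exists>i\<in>I. \<exists>n. b i n x \<noteq> b i n y"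
    and comult: "i \<in> I \<Longrightarrow>
      \<exists>L. binomial_family.filt (I <+> I) (pair_family b) (carrier G \<times> carrier G) n L \<and>
        (\<forall>x\<in>carrier G. \<forall>y\<in>carrier G. b i n (x \<otimes> y) = (\<Sum>k\<le>n. b i k x * b i (n - k) y) + L (x, y))"
begin

text \<open>This treats \<open>f\<close> as a linear functional on functions. Its values in the
  lowest degree where it is nonzero serve as the coefficients of the leading form of
  \<open>f\<close>.\<close>

definition pairing :: "('x \<Rightarrow> 'k) \<Rightarrow> ('i \<Rightarrow> nat) \<Rightarrow> 'k" where
  "pairing f \<alpha> = (\<Sum>x | f x \<noteq> 0. f x * mon \<alpha> x)"

lemma pairing_nonzero:
  assumes f: "f \<in> group_ring_carrier G" "f \<noteq> (\<lambda>_. 0)"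
  shows "\<exists>\<alpha>. pairing f \<alpha> \<noteq> 0"
proof (rule ccontr)
  assume none: "\<not> ?thesis"
  let ?S = "{x. f x \<noteq> 0}"
  have S: "finite ?S" "?S \<subseteq> carrier G" using f by (auto simp: group_ring_carrier_def)
  obtain s where s: "s \<in> ?S" using f by auto
  have "\<forall>t. \<exists>i n. t \<in> ?S - {s} \<longrightarrow> i \<in> I \<and> b i n s \<noteq> b i n t"
    using separates s S by blast
  then obtain i n where sep: "\<And>t. t \<in> ?S - {s} \<Longrightarrow> i t \<in> I \<and> b (i t) (n t) s \<noteq> b (i t) (n t) t"
    by metis
  \<comment> \<open>An interpolating function: it vanishes on the support of \<open>f\<close> except
    at \<open>s\<close>, and it lies in the span of the monomials.\<close>
  let ?\<phi> = "\<lambda>x. \<Prod>t\<in>?S - {s}. b (i t) (n t) x + - b (i t) (n t) t"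
  have "filt (Suc (sum n (?S - {s}))) ?\<phi>"
    using S sep by (intro filt_prod filt_add filt_gen filt_const) auto
  then have "(\<Sum>x\<in>?S. f x * ?\<phi> x) = 0"
    by (rule sum_filt_eq_0) (use S none in \<open>auto simp: pairing_def\<close>)
  moreover have "(\<Sum>x\<in>?S. f x * ?\<phi> x) = (\<Sum>x\<in>?S. if x = s then f s * ?\<phi> s else 0)"
    using S by (intro sum.cong) auto
  moreover have "?\<phi> s \<noteq> 0" using S sep by (auto simp: prod_zero_iff)
  ultimately show False using S s by simp
qed

text \<open>Multiply the formulas \<open>comult\<close> over all \<open>i\<close>; by
  \<open>filt_prod_perturb\<close> the errors only contribute below degree
  \<open>sum \<alpha> I\<close>.\<close>

lemma mon_comult:
  "\<exists>R. binomial_family.filt (I <+> I) (pair_family b) (carrier G \<times> carrier G) (sum \<alpha> I) R \<and>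
    (\<forall>x\<in>carrier G. \<forall>y\<in>carrier G. mon \<alpha> (x \<otimes> y) =
      (\<Sum>\<beta>\<in>PiE I (\<lambda>i. {..\<alpha> i}). mon \<beta> x * mon (\<lambda>i. \<alpha> i - \<beta> i) y) + R (x, y))"
proof -
  interpret pair: binomial_family "I <+> I" "pair_family b" "carrier G \<times> carrier G"
    by (rule binomial_family_pair)
  have "\<forall>i\<in>I. \<exists>L. pair.filt (\<alpha> i) L \<and> (\<forall>x\<in>carrier G. \<forall>y\<in>carrier G.
      b i (\<alpha> i) (x \<otimes> y) = (\<Sum>k\<le>\<alpha> i. b i k x * b i (\<alpha> i - k) y) + L (x, y))"
    by (intro ballI comult)
  then obtain L where L: "\<forall>i\<in>I. pair.filt (\<alpha> i) (L i) \<and> (\<forall>x\<in>carrier G. \<forall>y\<in>carrier G.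
      b i (\<alpha> i) (x \<otimes> y) = (\<Sum>k\<le>\<alpha> i. b i k x * b i (\<alpha> i - k) y) + L i (x, y))"
    by (rule bchoice[THEN exE])
  define T where "T i z = (\<Sum>k\<le>\<alpha> i. b i k (fst z) * b i (\<alpha> i - k) (snd z))" for i z
  have "pair.filt (Suc (\<alpha> i)) (T i)" if "i \<in> I" for i
    unfolding T_def
  proof (rule pair.filt_sum)
    fix k assume k: "k \<in> {..\<alpha> i}"
    show "pair.filt (Suc (\<alpha> i)) (\<lambda>z. b i k (fst z) * b i (\<alpha> i - k) (snd z))"
      using pair.filt_mult_Suc[OF pair.filt_gen[of "Inl i" k] pair.filt_gen[of "Inr i" "\<alpha> i - k"]] k that
      by auto
  qed
  then have "pair.filt (sum \<alpha> I) (\<lambda>z. (\<Prod>i\<in>I. T i z + L i z) - (\<Prod>i\<in>I. T i z))"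
    using L finite_J by (intro pair.filt_prod_perturb) auto
  moreover have "mon \<alpha> (x \<otimes> y) = (\<Prod>i\<in>I. T i (x, y) + L i (x, y))"
    if "x \<in> carrier G" "y \<in> carrier G" for x y
    unfolding mon_def T_def using that L by (intro prod.cong) auto
  moreover have "(\<Prod>i\<in>I. T i (x, y)) = (\<Sum>\<beta>\<in>PiE I (\<lambda>i. {..\<alpha> i}). mon \<beta> x * mon (\<lambda>i. \<alpha> i - \<beta> i) y)" for x y
    by (simp add: T_def mon_def prod_sum_PiE finite_J prod.distrib)
  ultimately show ?thesis
    by (intro exI[of _ "\<lambda>z. (\<Prod>i\<in>I. T i z + L i z) - (\<Prod>i\<in>I. T i z)"]) simp
qed

text \<open>A monomial of degree below \<open>m + n\<close> on pairs splits into a part in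
  \<open>x\<close> of degree below \<open>m\<close> or a part in \<open>y\<close> of degree below
  \<open>n\<close>, and that part is killed.\<close>

lemma pairing_filt_eq_0:
  assumes R: "binomial_family.filt (I <+> I) (pair_family b) (carrier G \<times> carrier G) (m + n) R"
    and f: "f \<in> group_ring_carrier G" "\<And>\<alpha>. sum \<alpha> I < m \<Longrightarrow> pairing f \<alpha> = 0"
    and g: "g \<in> group_ring_carrier G" "\<And>\<alpha>. sum \<alpha> I < n \<Longrightarrow> pairing g \<alpha> = 0"
  shows "(\<Sum>x | f x \<noteq> 0. \<Sum>y | g y \<noteq> 0. f x * g y * R (x, y)) = 0"
proof -
  interpret pair: binomial_family "I <+> I" "pair_family b" "carrier G \<times> carrier G"
    by (rule binomial_family_pair)
  let ?S = "{x. f x \<noteq> 0}" and ?T = "{y. g y \<noteq> 0}"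
  have "(\<Sum>z\<in>?S \<times> ?T. (f (fst z) * g (snd z)) * R z) = 0"
    using R
  proof (rule pair.sum_filt_eq_0)
    show "?S \<times> ?T \<subseteq> carrier G \<times> carrier G"
      using f g by (auto simp: group_ring_carrier_def)
    fix \<delta> assume "sum \<delta> (I <+> I) < m + n"
    then have "sum (\<delta> \<circ> Inl) I < m \<or> sum (\<delta> \<circ> Inr) I < n"
      by (auto simp: sum.Plus finite_J)
    moreover have "(\<Sum>z\<in>?S \<times> ?T. (f (fst z) * g (snd z)) * pair.mon \<delta> z)
        = pairing f (\<delta> \<circ> Inl) * pairing g (\<delta> \<circ> Inr)"
      by (simp add: pairing_def sum_product sum.cartesian_product pair.mon_def mon_def prod.Plus finite_J
          case_prod_beta mult_ac)
    ultimately show "(\<Sum>z\<in>?S \<times> ?T. (f (fst z) * g (snd z)) * pair.mon \<delta> z) = 0"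
      using f(2) g(2) by auto
  qed
  then show ?thesis by (simp add: sum.cartesian_product case_prod_beta)
qed

text \<open>Evaluate the zero product on \<open>\<phi>\<close> and regroup by the fibres of the
  multiplication over the finite set \<open>Z\<close>.\<close>

lemma sum_group_ring_mult_eq_0:
  assumes f: "f \<in> group_ring_carrier G" and g: "g \<in> group_ring_carrier G"
    and fg: "group_ring_mult G f g = (\<lambda>_. 0)"
  shows "(\<Sum>x | f x \<noteq> 0. \<Sum>y | g y \<noteq> 0. f x * g y * \<phi> (x \<otimes> y)) = 0"
proof -
  let ?S = "{x. f x \<noteq> 0}" and ?T = "{y. g y \<noteq> 0}"
  define Z where "Z = (\<lambda>(x, y). x \<otimes> y) ` (?S \<times> ?T)"
  have fin: "finite ?S" "finite ?T" using f g by (auto simp: group_ring_carrier_def)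
  then have Z: "finite Z" by (simp add: Z_def)
  have "0 = (\<Sum>z\<in>Z. group_ring_mult G f g z * \<phi> z)" by (simp add: fg)
  also have "\<dots> = (\<Sum>z\<in>Z. \<Sum>x\<in>?S. \<Sum>y\<in>?T. if x \<otimes> y = z then f x * g y * \<phi> z else 0)"
    unfolding group_ring_mult_def by (simp add: sum_distrib_right if_distrib[of "\<lambda>c. c * _"] cong: if_cong)
  also have "\<dots> = (\<Sum>x\<in>?S. \<Sum>y\<in>?T. \<Sum>z\<in>Z. if x \<otimes> y = z then f x * g y * \<phi> z else 0)"
    by (subst sum.swap, rule sum.cong[OF refl], rule sum.swap)
  also have "\<dots> = (\<Sum>x\<in>?S. \<Sum>y\<in>?T. f x * g y * \<phi> (x \<otimes> y))"
    using Z by (intro sum.cong refl) (auto simp: Z_def)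
  finally show ?thesis by simp
qed

text \<open>Let \<open>m\<close> and \<open>n\<close> be the lowest degrees in which
  \<open>f\<close> and \<open>g\<close> pair nontrivially. Evaluating the product on the monomial
  \<open>\<alpha> = s + t\<close> leaves the single nonzero term
  \<open>pairing f s * pairing g t\<close>.\<close>

theorem group_ring_is_domain: "group_ring_is_domain G TYPE('k)"
  unfolding group_ring_is_domain_def
proof (intro ballI impI notI)
  fix f g :: "'x \<Rightarrow> 'k"
  assume f: "f \<in> group_ring_carrier G" "f \<noteq> (\<lambda>_. 0)"
    and g: "g \<in> group_ring_carrier G" "g \<noteq> (\<lambda>_. 0)"
    and fg: "group_ring_mult G f g = (\<lambda>_. 0)"
  have least: "\<exists>m. (\<exists>\<alpha>. sum \<alpha> I = m \<and> pairing h \<alpha> \<noteq> 0) \<and> (\<forall>\<alpha>. sum \<alpha> I < m \<longrightarrow> pairing h \<alpha> = 0)"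
    if "h \<in> group_ring_carrier G" "h \<noteq> (\<lambda>_. 0)" for h
    using pairing_nonzero[OF that] ex_has_least_nat[of "\<lambda>\<alpha>. pairing h \<alpha> \<noteq> 0" _ "\<lambda>\<alpha>. sum \<alpha> I"]
    by (metis not_le)
  obtain m where m: "\<exists>\<alpha>. sum \<alpha> I = m \<and> pairing f \<alpha> \<noteq> 0" "\<And>\<alpha>. sum \<alpha> I < m \<Longrightarrow> pairing f \<alpha> = 0"
    using least[OF f] by blast
  obtain n where n: "\<exists>\<alpha>. sum \<alpha> I = n \<and> pairing g \<alpha> \<noteq> 0" "\<And>\<alpha>. sum \<alpha> I < n \<Longrightarrow> pairing g \<alpha> = 0"
    using least[OF g] by blast
  define S where "S = {\<alpha>. sum \<alpha> I = m \<and> pairing f \<alpha> \<noteq> 0}"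
  define T where "T = {\<alpha>. sum \<alpha> I = n \<and> pairing g \<alpha> \<noteq> 0}"
  have "S \<noteq> {}" "T \<noteq> {}" using m n by (auto simp: S_def T_def)
  from exists_unique_sum[OF finite_J this] obtain s t where st: "s \<in> S" "t \<in> T" and
    uniq: "\<forall>s'\<in>S. \<forall>t'\<in>T. (\<forall>i\<in>I. s' i + t' i = s i + t i) \<longrightarrow> (\<forall>i\<in>I. s' i = s i)"
    by (elim bexE)
  define \<alpha> where "\<alpha> i = s i + t i" for i
  let ?B = "PiE I (\<lambda>i. {..\<alpha> i})"
  have sum_\<alpha>: "sum \<alpha> I = m + n" using st by (simp add: \<alpha>_def S_def T_def sum.distrib)
  obtain R where R: "binomial_family.filt (I <+> I) (pair_family b) (carrier G \<times> carrier G) (m + n) R"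
    "\<And>x y. x \<in> carrier G \<Longrightarrow> y \<in> carrier G \<Longrightarrow>
      mon \<alpha> (x \<otimes> y) = (\<Sum>\<beta>\<in>?B. mon \<beta> x * mon (\<lambda>i. \<alpha> i - \<beta> i) y) + R (x, y)"
    using mon_comult[of \<alpha>] sum_\<alpha> by auto
  have finB: "finite ?B" using finite_J by (intro finite_PiE) auto
  have "0 = (\<Sum>x | f x \<noteq> 0. \<Sum>y | g y \<noteq> 0. f x * g y * mon \<alpha> (x \<otimes> y))"
    using sum_group_ring_mult_eq_0[OF f(1) g(1) fg] by simp
  also have "\<dots> = (\<Sum>x | f x \<noteq> 0. \<Sum>y | g y \<noteq> 0.
      (\<Sum>\<beta>\<in>?B. (f x * mon \<beta> x) * (g y * mon (\<lambda>i. \<alpha> i - \<beta> i) y)) + f x * g y * R (x, y))"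
    using f(1) g(1)
    by (intro sum.cong refl) (auto simp: group_ring_carrier_def subset_iff R(2) algebra_simps sum_distrib_left)
  also have "\<dots> = (\<Sum>x | f x \<noteq> 0. \<Sum>y | g y \<noteq> 0. \<Sum>\<beta>\<in>?B.
      (f x * mon \<beta> x) * (g y * mon (\<lambda>i. \<alpha> i - \<beta> i) y))"
    using pairing_filt_eq_0[OF R(1) f(1) m(2) g(1) n(2)] by (simp add: sum.distrib)
  also have "\<dots> = (\<Sum>x | f x \<noteq> 0. \<Sum>\<beta>\<in>?B. \<Sum>y | g y \<noteq> 0.
      (f x * mon \<beta> x) * (g y * mon (\<lambda>i. \<alpha> i - \<beta> i) y))"
    by (intro sum.cong refl sum.swap)
  also have "\<dots> = (\<Sum>\<beta>\<in>?B. \<Sum>x | f x \<noteq> 0. \<Sum>y | g y \<noteq> 0.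
      (f x * mon \<beta> x) * (g y * mon (\<lambda>i. \<alpha> i - \<beta> i) y))"
    by (rule sum.swap)
  also have "\<dots> = (\<Sum>\<beta>\<in>?B. pairing f \<beta> * pairing g (\<lambda>i. \<alpha> i - \<beta> i))"
    by (simp add: pairing_def sum_product)
  \<comment> \<open>Members of \<open>PiE\<close> are extensional, so the surviving exponent is
    \<open>restrict s I\<close>.\<close>
  also have "\<dots> = (\<Sum>\<beta>\<in>?B. if \<beta> = restrict s I then pairing f s * pairing g t else 0)"
  proof (intro sum.cong refl)
    fix \<beta> assume \<beta>: "\<beta> \<in> ?B"
    let ?\<gamma> = "\<lambda>i. \<alpha> i - \<beta> i"
    have add: "\<beta> i + ?\<gamma> i = s i + t i" if "i \<in> I" for i
      using \<beta> that by (auto simp: \<alpha>_def PiE_iff)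
    then have deg: "sum \<beta> I + sum ?\<gamma> I = m + n"
      unfolding sum.distrib[symmetric] sum_\<alpha>[symmetric] \<alpha>_def by (intro sum.cong) auto
    show "pairing f \<beta> * pairing g ?\<gamma> = (if \<beta> = restrict s I then pairing f s * pairing g t else 0)"
    proof (cases "\<beta> = restrict s I")
      case True
      then have "mon \<beta> = mon s" "mon ?\<gamma> = mon t"
        by (auto simp: mon_def \<alpha>_def intro!: ext prod.cong)
      then show ?thesis using True by (simp add: pairing_def)
    next
      case False
      have "\<not> (\<beta> \<in> S \<and> ?\<gamma> \<in> T)"
      proof
        assume "\<beta> \<in> S \<and> ?\<gamma> \<in> T"
        then have "\<forall>i\<in>I. \<beta> i = s i" using uniq[THEN bspec, of \<beta>, THEN bspec, of ?\<gamma>] add by auto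
        then have "\<beta> i = restrict s I i" for i
          using \<beta> by (cases "i \<in> I") (auto simp: PiE_iff extensional_def)
        then show False using False by blast
      qed
      \<comment> \<open>Below degree \<open>m\<close> the first factor is zero; above it,
        \<open>?\<gamma>\<close> has degree below \<open>n\<close>; in degree \<open>m\<close> the
        uniqueness applies.\<close>
      then have "pairing f \<beta> = 0 \<or> pairing g ?\<gamma> = 0"
        using deg m(2)[of \<beta>] n(2)[of ?\<gamma>] unfolding S_def T_def
        by (cases "sum \<beta> I" m rule: linorder_cases) auto
      then show ?thesis using False by auto
    qed
  qed
  also have "\<dots> = pairing f s * pairing g t"
    using finB by (simp add: \<alpha>_def PiE_iff)
  finally show False using st by (simp add: S_def T_def)
qed

end

section \<open>Congruence subgroups\<close>

text \<open>The entry at position \<open>i\<close> of the matrix \<open>X\<close> with \<open>A = 1 + p ^ u * X\<close>, modulo \<open>p ^ N\<close>;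
  on the diagonal the division discards the summand 1.\<close>

definition coord :: "nat \<Rightarrow> nat \<Rightarrow> nat \<Rightarrow> nat \<times> nat \<Rightarrow> (nat \<Rightarrow> nat \<Rightarrow> nat \<Rightarrow> int) \<Rightarrow> nat" where
  "coord p u N i A = nat (A (fst i) (snd i) (u + N) div int p ^ u)"

text \<open>Modulo \<open>p\<close>, the value of \<open>x choose n\<close> at a p-adic integer \<open>x\<close> depends only on the residue of
  \<open>x\<close> modulo \<open>p ^ n > n\<close>.\<close>

definition coord_choose :: "nat \<Rightarrow> nat \<Rightarrow> nat \<times> nat \<Rightarrow> nat \<Rightarrow> (nat \<Rightarrow> nat \<Rightarrow> nat \<Rightarrow> int) \<Rightarrow> 'k::field" where
  "coord_choose p u i n A = of_nat (coord p u n i A choose n)"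

section \<open>Residues of entries and coordinates modulo powers of \<open>p\<close>\<close>

lemma zp_seq_mod:
  assumes x: "zp_seq p x" and "n \<le> m"
  shows "x m mod int p ^ n = x n"
  using assms(2)
proof (induction rule: dec_induct)
  case base
  have "0 \<le> x n" "x n < int p ^ n" using x unfolding zp_seq_def by blast+
  then show ?case by simp
next
  case (step m)
  have "x (Suc m) mod int p ^ n = (x (Suc m) mod int p ^ m) mod int p ^ n"
    using step.hyps by (simp add: mod_mod_cancel le_imp_power_dvd)
  also have "x (Suc m) mod int p ^ m = x m" using x unfolding zp_seq_def by metis
  finally show ?case using step.IH by simp
qed

lemma mod_mult_of_small:
  fixes P Q c r :: int
  assumes "0 \<le> r" and "r < P" and "0 \<le> Q"
  shows "(r + P * c) mod (P * Q) = r + P * (c mod Q)"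
  using assms by (simp add: zmod_zmult2_eq)

context
  fixes p d u :: nat
  assumes p: "prime p" and u: "u > 0"
begin

lemma one_less_int_power: "1 < int p ^ u"
  using prime_gt_1_nat[OF p] u by (intro one_less_power) auto

lemma less_prime_power: "n < p ^ n"
  using prime_gt_1_nat[OF p] by (intro power_gt_expt) auto

lemma CS_entry:
  assumes A: "A \<in> CS u d p" and i: "a < d" "b < d"
  shows "A a b (u + N) = of_bool (a = b) + int p ^ u * int (coord p u N (a, b) A)"
    and "coord p u N (a, b) A < p ^ N"
proof -
  have z: "zp_seq p (A a b)" and one: "A a b u = padic_mat_one p d a b u"
    using A i by (auto simp: CS_def padic_mat_def)
  have pos: "0 \<le> A a b (u + N)" and less: "A a b (u + N) < int p ^ (u + N)"
    using z unfolding zp_seq_def by blast+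
  have c: "int (coord p u N (a, b) A) = A a b (u + N) div int p ^ u"
    using pos prime_gt_0_nat[OF p] by (simp add: coord_def pos_imp_zdiv_nonneg_iff)
  \<comment> \<open>The diagonal of the identity is \<open>1 mod int p ^ u\<close>, which equals 1
    because \<open>u > 0\<close>.\<close>
  have "A a b (u + N) mod int p ^ u = of_bool (a = b)"
    using zp_seq_mod[OF z, of u "u + N"] one i one_less_int_power by (simp add: padic_mat_one_def)
  then show entry: "A a b (u + N) = of_bool (a = b) + int p ^ u * int (coord p u N (a, b) A)"
    unfolding c using mult_div_mod_eq[of "int p ^ u" "A a b (u + N)"] by linarith
  have "int p ^ u * int (coord p u N (a, b) A) < int p ^ u * int p ^ N"
    using less entry by (cases "a = b") (auto simp: power_add)
  then have "int (coord p u N (a, b) A) < int p ^ N"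
    using prime_gt_0_nat[OF p] by (subst (asm) mult_less_cancel_left_pos) auto
  then show "coord p u N (a, b) A < p ^ N"
    by (simp flip: of_nat_power)
qed

text \<open>The coordinates at varying precision are compatible, so each one is again a p-adic
  integer.\<close>

lemma coord_mod:
  assumes A: "A \<in> CS u d p" and i: "i \<in> {..<d} \<times> {..<d}" and "N \<le> M"
  shows "coord p u M i A mod p ^ N = coord p u N i A"
proof -
  obtain a b where ab: "i = (a, b)" "a < d" "b < d" using i by auto
  have z: "zp_seq p (A a b)" using A ab by (auto simp: CS_def padic_mat_def)
  have "A a b (u + N) = A a b (u + M) mod (int p ^ u * int p ^ N)"
    using zp_seq_mod[OF z, of "u + N" "u + M"] assms(3) by (simp add: power_add)
  also have "\<dots> = of_bool (a = b) + int p ^ u * (int (coord p u M i A) mod int p ^ N)"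
    using one_less_int_power ab by (simp add: CS_entry[OF A] mod_mult_of_small)
  finally have "int p ^ u * int (coord p u N i A) = int p ^ u * (int (coord p u M i A) mod int p ^ N)"
    using ab by (simp add: CS_entry(1)[OF A])
  then have "int (coord p u N i A) = int (coord p u M i A) mod int p ^ N"
    using one_less_int_power by (subst (asm) mult_cancel_left) linarith
  then show ?thesis by (simp flip: of_nat_mod of_nat_power)
qed

lemma coord_mult:
  assumes A: "A \<in> CS u d p" and B: "B \<in> CS u d p" and i: "a < d" "b < d"
  shows "coord p u N (a, b) (padic_mat_mult p d A B) =
    (p ^ u * (\<Sum>c<d. coord p u N (a, c) A * coord p u N (c, b) B)
      + (coord p u N (a, b) A + coord p u N (a, b) B)) mod p ^ N"
proof -
  let ?X = "\<lambda>i. int (coord p u N i A)" and ?Y = "\<lambda>i. int (coord p u N i B)" and ?P = "int p ^ u"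
  let ?Z = "?P * (\<Sum>c<d. ?X (a, c) * ?Y (c, b)) + (?X (a, b) + ?Y (a, b))"
  have "(\<Sum>c<d. A a c (u + N) * B c b (u + N)) =
      (\<Sum>c<d. (if c = a then of_bool (a = b) + ?P * ?Y (a, b) else 0)
        + (if c = b then ?P * ?X (a, b) else 0) + ?P * (?P * (?X (a, c) * ?Y (c, b))))"
    using i by (intro sum.cong) (auto simp: CS_entry(1)[OF A] CS_entry(1)[OF B] ring_distribs mult_ac)
  also have "\<dots> = of_bool (a = b) + ?P * ?Z"
    using i by (simp add: sum.distrib algebra_simps sum_distrib_left)
  finally have "padic_mat_mult p d A B a b (u + N) = of_bool (a = b) + ?P * (?Z mod int p ^ N)"
    using i one_less_int_power by (simp add: padic_mat_mult_def power_add mod_mult_of_small)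
  moreover have "(of_bool (a = b) + ?P * k) div ?P = k" for k
    using one_less_int_power prime_gt_0_nat[OF p] by (subst div_mult_self2) auto
  ultimately have "coord p u N (a, b) (padic_mat_mult p d A B) = nat (?Z mod int p ^ N)"
    unfolding coord_def[of p u N "(a, b)" "padic_mat_mult p d A B"] fst_conv snd_conv by presburger
  also have "?Z mod int p ^ N = int ((p ^ u * (\<Sum>c<d. coord p u N (a, c) A * coord p u N (c, b) B)
      + (coord p u N (a, b) A + coord p u N (a, b) B)) mod p ^ N)"
    by (simp add: of_nat_mod)
  finally show ?thesis by simp
qed

section \<open>Binomial functions of the coordinates with values in \<open>k\<close>\<close>

context
  assumes char: "CHAR('k::field) = p"
begin

text \<open>Reduce the finer of the two residues, at precisions \<open>n\<close> and
  \<open>N\<close>, to the coarser one; \<open>n\<close> is below the modulus in both cases.\<close>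

lemma coord_choose_eq:
  assumes A: "A \<in> CS u d p" and i: "i \<in> {..<d} \<times> {..<d}" and n: "n < p ^ N"
  shows "coord_choose p u i n A = (of_nat (coord p u N i A choose n) :: 'k)"
proof (cases "N \<le> n")
  case True
  then show ?thesis
    using of_nat_choose_mod_CHAR_power[of n N "coord p u n i A", where ?'k = 'k] coord_mod[OF A i True] p char n
    by (simp add: coord_choose_def)
next
  case False
  show ?thesis
    using of_nat_choose_mod_CHAR_power[of n n "coord p u N i A", where ?'k = 'k] coord_mod[OF A i, of n N] p char False
      less_prime_power[of n]
    by (simp add: coord_choose_def)
qed

lemma coord_choose_eq_le:
  assumes "A \<in> CS u d p" and "i \<in> {..<d} \<times> {..<d}" and "n \<le> N"
  shows "coord_choose p u i n A = (of_nat (coord p u N i A choose n) :: 'k)"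
  using assms less_prime_power[of N] by (intro coord_choose_eq) auto

lemma binomial_family_CS:
  "binomial_family ({..<d} \<times> {..<d}) (coord_choose p u :: _ \<Rightarrow> _ \<Rightarrow> _ \<Rightarrow> 'k) (CS u d p)"
proof
  fix i m n assume i: "i \<in> {..<d} \<times> {..<d}"
  obtain q where q: "\<And>x. of_nat (x choose m) * of_nat (x choose n)
     = (\<Sum>c\<le>m + n. q c * (of_nat (x choose c) :: 'k))"
    using of_nat_choose_times_choose_span by metis
  show "\<exists>q :: nat \<Rightarrow> 'k. \<forall>A\<in>CS u d p. coord_choose p u i m A * coord_choose p u i n A
      = (\<Sum>c\<le>m + n. q c * coord_choose p u i c A)"
    \<comment> \<open>Precision \<open>m + n\<close> is common to all the indices that
      occur.\<close>
    using i by (intro exI[of _ q]) (simp add: coord_choose_eq_le[where N = "m + n"] q)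
qed (simp_all add: coord_choose_def)

text \<open>Where the residues differ, take the larger one as \<open>n\<close>: the binomial is 1
  there and 0 at the smaller residue.\<close>

lemma coord_choose_separates:
  assumes A: "A \<in> CS u d p" and B: "B \<in> CS u d p" and "A \<noteq> B"
  shows "\<exists>i\<in>{..<d} \<times> {..<d}. \<exists>n. coord_choose p u i n A \<noteq> (coord_choose p u i n B :: 'k)"
proof -
  obtain a b m where m: "A a b m \<noteq> B a b m" using \<open>A \<noteq> B\<close> by (auto simp: fun_eq_iff)
  have ab: "a < d" "b < d"
    using m A B unfolding CS_def padic_mat_def mem_Collect_eq by metis+
  then have z: "zp_seq p (A a b)" "zp_seq p (B a b)"
    using A B by (auto simp: CS_def padic_mat_def)
  \<comment> \<open>Precision \<open>m\<close> of \<open>coord\<close> reads the entries modulo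
    \<open>p ^ (u + m)\<close>, where the difference persists.\<close>
  have "A a b (u + m) \<noteq> B a b (u + m)"
    using m zp_seq_mod[OF z(1), of m "u + m"] zp_seq_mod[OF z(2), of m "u + m"] by auto
  then have neq: "coord p u m (a, b) A \<noteq> coord p u m (a, b) B"
    using ab by (simp add: CS_entry(1)[OF A] CS_entry(1)[OF B])
  have "\<exists>n < p ^ m. of_nat (coord p u m (a, b) A choose n) \<noteq> (of_nat (coord p u m (a, b) B choose n) :: 'k)"
  proof (cases "coord p u m (a, b) A < coord p u m (a, b) B")
    case True
    then show ?thesis
      using CS_entry(2)[OF B ab, of m] by (intro exI[of _ "coord p u m (a, b) B"]) (simp add: binomial_eq_0)
  next
    case False
    then show ?thesis
      using CS_entry(2)[OF A ab, of m] neq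
      by (intro exI[of _ "coord p u m (a, b) A"]) (simp add: binomial_eq_0)
  qed
  then obtain n where "n < p ^ m"
    "of_nat (coord p u m (a, b) A choose n) \<noteq> (of_nat (coord p u m (a, b) B choose n) :: 'k)"
    by blast
  then show ?thesis
    using ab coord_choose_eq[OF A _ \<open>n < p ^ m\<close>, of "(a, b)"] coord_choose_eq[OF B _ \<open>n < p ^ m\<close>, of "(a, b)"]
    by (intro bexI[of _ "(a, b)"] exI[of _ n]) auto
qed

text \<open>Modulo \<open>p ^ n\<close> the coordinate of the product is
  \<open>p ^ u * w + s\<close>. In Vandermonde's expansion the term \<open>j = 0\<close> is
  \<open>s choose n\<close>, which expands to the main term; the terms \<open>j \<ge> 1\<close> form
  \<open>L\<close>.\<close>

lemma coord_choose_comult: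
  assumes i: "i \<in> {..<d} \<times> {..<d}" and pu: "p ^ u > 2"
  shows "\<exists>L. binomial_family.filt ({..<d} \<times> {..<d} <+> {..<d} \<times> {..<d})
      (pair_family (coord_choose p u :: _ \<Rightarrow> _ \<Rightarrow> _ \<Rightarrow> 'k)) (CS u d p \<times> CS u d p) n L \<and>
    (\<forall>A\<in>CS u d p. \<forall>B\<in>CS u d p. coord_choose p u i n (padic_mat_mult p d A B)
      = (\<Sum>k\<le>n. coord_choose p u i k A * coord_choose p u i (n - k) B) + L (A, B))"
proof -
  interpret CS: binomial_family "{..<d} \<times> {..<d}" "coord_choose p u :: _ \<Rightarrow> _ \<Rightarrow> _ \<Rightarrow> 'k" "CS u d p"
    by (rule binomial_family_CS)
  interpret pair: binomial_family "{..<d} \<times> {..<d} <+> {..<d} \<times> {..<d}"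
    "pair_family (coord_choose p u :: _ \<Rightarrow> _ \<Rightarrow> _ \<Rightarrow> 'k)" "CS u d p \<times> CS u d p"
    by (rule CS.binomial_family_pair)
  obtain a b where ab: "i = (a, b)" "a < d" "b < d" using i by auto
  define s where "s z = coord p u n i (fst z) + coord p u n i (snd z)" for z
  define w where "w z = (\<Sum>c<d. coord p u n (a, c) (fst z) * coord p u n (c, b) (snd z))" for z
  define h where "h j z = of_nat ((p ^ u * w z) choose j) * (of_nat (s z choose (n - j)) :: 'k)" for j z
  \<comment> \<open>Residues at precision \<open>n\<close> represent the binomial functions of index
    up to \<open>n\<close>, whence the bound \<open>n\<close> here.\<close>
  have fst: "pair.nat_degree_le n 1 (\<lambda>z. coord p u n j (fst z))" if "j \<in> {..<d} \<times> {..<d}" for j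
    unfolding pair.nat_degree_le_def
  proof (intro allI impI)
    fix m assume "m \<le> n"
    then show "pair.filt (Suc (1 * m)) (\<lambda>z. of_nat (coord p u n j (fst z) choose m))"
      using pair.filt_gen[OF InlI[OF that], of m] that
      by (auto elim!: pair.filt_cong simp: coord_choose_eq_le[where N = n])
  qed
  have snd: "pair.nat_degree_le n 1 (\<lambda>z. coord p u n j (snd z))" if "j \<in> {..<d} \<times> {..<d}" for j
    unfolding pair.nat_degree_le_def
  proof (intro allI impI)
    fix m assume "m \<le> n"
    then show "pair.filt (Suc (1 * m)) (\<lambda>z. of_nat (coord p u n j (snd z) choose m))"
      using pair.filt_gen[OF InrI[OF that], of m] that
      by (auto elim!: pair.filt_cong simp: coord_choose_eq_le[where N = n])
  qed
  have s: "pair.nat_degree_le n 1 s"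
    unfolding s_def using i by (intro pair.nat_degree_le_add fst snd)
  have w: "pair.nat_degree_le n (1 + 1) w"
    unfolding w_def using ab by (intro pair.nat_degree_le_sum pair.nat_degree_le_mult fst snd) auto
  \<comment> \<open>Only multiples \<open>j = p ^ u * r\<close> contribute, and \<open>w\<close> is quadratic, so the degree is
    \<open>2 * r + (n - j)\<close>. This is where \<open>u \<ge> 2\<close> is needed for \<open>p = 2\<close>.\<close>
  have "pair.filt n (h j)" if j: "j \<in> {1..n}" for j
  proof (cases "p ^ u dvd j")
    case False
    then have "h j z = 0" for z
      using of_nat_choose_CHAR_power_mult[where ?'k = 'k and u = u] p char by (simp add: h_def)
    then show ?thesis by (rule pair.filt.zero)
  next
    case True
    then obtain r where r: "j = p ^ u * r" ..
    then have "3 * r \<le> j" "r > 0" using pu j by auto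
    have "r \<le> n" using \<open>3 * r \<le> j\<close> j by auto
    have "pair.filt (Suc ((1 + 1) * r + 1 * (n - j))) (\<lambda>z. of_nat (w z choose r) * of_nat (s z choose (n - j)))"
      using w s \<open>r \<le> n\<close> by (intro pair.filt_mult_Suc) (simp_all only: pair.nat_degree_le_def diff_le_self)
    moreover have "of_nat ((p ^ u * w z) choose j) = (of_nat (w z choose r) :: 'k)" for z
      using of_nat_choose_CHAR_power_mult[where ?'k = 'k and u = u] p char pu r by simp
    ultimately have "pair.filt (Suc ((1 + 1) * r + 1 * (n - j))) (h j)"
      by (auto elim: pair.filt_cong simp: h_def)
    \<comment> \<open>From \<open>2 * r + 1 \<le> 3 * r \<le> j\<close> follows
      \<open>Suc (2 * r + (n - j)) \<le> n\<close>.\<close>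
    then show ?thesis
      by (rule pair.filt_mono) (use \<open>3 * r \<le> j\<close> \<open>r > 0\<close> j in auto)
  qed
  then have "pair.filt n (\<lambda>z. \<Sum>j=1..n. h j z)"
    by (rule pair.filt_sum)
  moreover have "coord_choose p u i n (padic_mat_mult p d A B)
      = (\<Sum>k\<le>n. coord_choose p u i k A * coord_choose p u i (n - k) B) + (\<Sum>j=1..n. h j (A, B))"
    if A: "A \<in> CS u d p" and B: "B \<in> CS u d p" for A B
  proof -
    have "coord_choose p u i n (padic_mat_mult p d A B) = (of_nat ((p ^ u * w (A, B) + s (A, B)) choose n) :: 'k)"
      using of_nat_choose_mod_CHAR_power[of n n "p ^ u * w (A, B) + s (A, B)", where ?'k = 'k] p char less_prime_power[of n]
      by (simp add: coord_choose_def ab coord_mult[OF A B] w_def s_def)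
    also have "\<dots> = (\<Sum>j\<le>n. h j (A, B))"
      by (simp add: h_def flip: vandermonde)
    also have "\<dots> = h 0 (A, B) + (\<Sum>j=1..n. h j (A, B))"
      by (simp add: atMost_atLeast0 sum.atLeast_Suc_atMost[of 0])
    also have "h 0 (A, B) = (\<Sum>k\<le>n. coord_choose p u i k A * coord_choose p u i (n - k) B)"
      using i by (simp add: h_def s_def coord_choose_eq_le[OF A, where N = n]
          coord_choose_eq_le[OF B, where N = n] flip: vandermonde)
    finally show ?thesis .
  qed
  ultimately show ?thesis by (intro exI[of _ "\<lambda>z. \<Sum>j=1..n. h j z"]) simp
qed

end

end

theorem theorem1p2:
  fixes p d u :: nat
  assumes "prime p" and "d > 0" and "u > 0" and "p = 2 \<longrightarrow> u \<ge> 2"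
    and "CHAR('k::field) = p"
  shows "group_ring_is_domain (CS_group u d p) TYPE('k)"
proof -
  \<comment> \<open>The condition for \<open>p = 2\<close> excludes exactly
    \<open>p ^ u = 2\<close>.\<close>
  have pu: "p ^ u > 2"
  proof (cases "p = 2")
    case True
    then have "2 ^ 2 \<le> p ^ u" using assms by (intro order_trans[OF power_increasing[of 2 u 2]]) auto
    then show ?thesis by simp
  next
    case False
    then have "2 < p" using prime_ge_2_nat[OF assms(1)] by simp
    also have "p \<le> p ^ u" using assms \<open>2 < p\<close> by (intro self_le_power) auto
    finally show ?thesis .
  qed
  interpret binomial_family "{..<d} \<times> {..<d}" "coord_choose p u :: _ \<Rightarrow> _ \<Rightarrow> _ \<Rightarrow> 'k"
    "carrier (CS_group u d p)"
    using binomial_family_CS assms by (simp add: CS_group_def)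
  interpret binomial_group "{..<d} \<times> {..<d}" "coord_choose p u :: _ \<Rightarrow> _ \<Rightarrow> _ \<Rightarrow> 'k" "CS_group u d p"
    by unfold_locales
      (use coord_choose_separates coord_choose_comult assms pu in \<open>simp_all add: CS_group_def\<close>)
  show ?thesis by (rule group_ring_is_domain)
qed

end
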